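(* Let $\mathcal{F}=(W,R)$ be a Kripke frame, let $\mathcal{F}^\bullet=(W,\{\nu_n\}_{n\in\mathbb{N}})$ be its associated graded neighbourhood frame, and let $V:\mathsf{Prop}\to\mathcal{P}(W)$ be a valuation. Then for all $w\in W$ and all $\mathcal{L}_g$-formulas $\varphi$, $$(\mathcal{F},V),w\Vdash\varphi\quad\text{iff}\quad(\mathcal{F}^\bullet,V),w\Vdash\varphi,$$ where the left-hand side is truth in a Kripke model and the right-hand side is truth in a neighbourhood model.
   Context: $\mathbb{N}$ is the set of natural numbers including $0$. Let $\mathsf{Prop}$ be a set of proposition letters. The language $\mathcal{L}_g$ is given by $\varphi::=p\mid\neg\varphi\mid(\varphi\lor\varphi)\mid\Diamond_n\varphi$ with $p\in\mathsf{Prop}$, $n\in\mathbb{N}$. A Kripke frame is a pair $(W,R)$ with $W$ a set and $R\subseteq W\times W$; write $R[w]=\{v\in W: wRv\}$. A Kripke model is a Kripke frame with a valuation $V:\mathsf{Prop}\to\mathcal{P}(W)$. Truth in a Kripke model $\mathcal{M}=(W,R,V)$: $\mathcal{M},w\Vdash p$ iff $w\in V(p)$; $\mathcal{M},w\Vdash\neg\psi$ iff not $\mathcal{M},w\Vdash\psi$; $\mathcal{M},w\Vdash\psi_1\lor\psi_2$ iff $\mathcal{M},w\Vdash\psi_1$ or $\mathcal{M},w\Vdash\psi_2$; $\mathcal{M},w\Vdash\Diamond_n\psi$ iff $|R[w]\cap\{v\in W:\mathcal{M},v\Vdash\psi\}|\ge n$. A neighbourhood frame is a tuple $(W,\{\nu_n\}_{n\in\mathbb{N}})$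 with $W$ a set and $\nu_n:W\to\mathcal{P}(\mathcal{P}(W))$ for each $n$. A neighbourhood model $\mathbb{M}$ is a neighbourhood frame with a valuation $V:\mathsf{Prop}\to\mathcal{P}(W)$. Truth in $\mathbb{M}$: same clauses for $p,\neg,\lor$, and $\mathbb{M},w\Vdash\Diamond_n\psi$ iff $\{v\in W:\mathbb{M},v\Vdash\psi\}\in\nu_n(w)$. For a set $X$, $\mathcal{P}_{\ge n}(X)=\{X'\subseteq X:|X'|\ge n\}$. For $\Gamma\subseteq\mathcal{P}(W)$, $\uparrow\Gamma=\{Y\in\mathcal{P}(W):\exists X\in\Gamma,\ X\subseteq Y\}$. For a Kripke frame $\mathcal{F}=(W,R)$, the associated graded neighbourhood frame is $\mathcal{F}^\bullet=(W,\{\nu_n\}_{n\in\mathbb{N}})$ with $\nu_n(w)=\uparrow\mathcal{P}_{\ge n}(R[w])$ for all $w\in W$, $n\in\mathbb{N}$. *)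

theory Defs
  imports Main "HOL-Library.Equipollence"
begin

text \<open>Proposition letters are the elements of the type \<open>'p\<close>.\<close>

datatype 'p fm =
    Atom 'p
  | Neg "'p fm"
  | Disj "'p fm" "'p fm"
  | Dia nat "'p fm"

text \<open>The condition \<open>|X| \<ge> n\<close>, stated as the existence of an injection from an \<open>n\<close>-element set
  because \<^const>\<open>card\<close> is \<open>0\<close> on infinite sets.\<close>

definition card_ge :: "'w set \<Rightarrow> nat \<Rightarrow> bool" where
  "card_ge X n \<longleftrightarrow> {..<n} \<lesssim> X"

lemma card_ge_iff: "card_ge X n \<longleftrightarrow> infinite X \<or> n \<le> card X"
proof (cases "finite X")
  case True
  then show ?thesis
    by (simp add: card_ge_def lepoll_iff_card_le)
next
  case False
  then show ?thesis
    by (simp add: card_ge_def finite_lepoll_infinite)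
qed

text \<open>The records carry the raw data; \<open>kripke_frame\<close> and \<open>nbhd_frame\<close> express that the data
  live on the (possibly empty) set of worlds.\<close>

record 'w kframe =
  kworlds :: "'w set"
  krel :: "('w \<times> 'w) set"

record 'w nframe =
  nworlds :: "'w set"
  nbhds :: "nat \<Rightarrow> 'w \<Rightarrow> 'w set set"

definition kripke_frame :: "'w kframe \<Rightarrow> bool" where
  "kripke_frame F \<longleftrightarrow> krel F \<subseteq> kworlds F \<times> kworlds F"

definition nbhd_frame :: "'w nframe \<Rightarrow> bool" where
  "nbhd_frame N \<longleftrightarrow> (\<forall>n. \<forall>w \<in> nworlds N. nbhds N n w \<subseteq> Pow (nworlds N))"

definition valuation :: "'w set \<Rightarrow> ('p \<Rightarrow> 'w set) \<Rightarrow> bool" where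
  "valuation W V \<longleftrightarrow> (\<forall>p. V p \<subseteq> W)"

definition succs :: "'w kframe \<Rightarrow> 'w \<Rightarrow> 'w set" where
  "succs F w = {v \<in> kworlds F. (w, v) \<in> krel F}"

type_synonym ('w, 'p) kmodel = "'w kframe \<times> ('p \<Rightarrow> 'w set)"
type_synonym ('w, 'p) nmodel = "'w nframe \<times> ('p \<Rightarrow> 'w set)"

fun ksat :: "('w, 'p) kmodel \<Rightarrow> 'w \<Rightarrow> 'p fm \<Rightarrow> bool" where
  "ksat (F, V) w (Atom p) \<longleftrightarrow> w \<in> V p"
| "ksat (F, V) w (Neg \<phi>) \<longleftrightarrow> \<not> ksat (F, V) w \<phi>"
| "ksat (F, V) w (Disj \<phi> \<psi>) \<longleftrightarrow> ksat (F, V) w \<phi> \<or> ksat (F, V) w \<psi>"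
| "ksat (F, V) w (Dia n \<phi>) \<longleftrightarrow> card_ge (succs F w \<inter> {v \<in> kworlds F. ksat (F, V) v \<phi>}) n"

fun nsat :: "('w, 'p) nmodel \<Rightarrow> 'w \<Rightarrow> 'p fm \<Rightarrow> bool" where
  "nsat (N, V) w (Atom p) \<longleftrightarrow> w \<in> V p"
| "nsat (N, V) w (Neg \<phi>) \<longleftrightarrow> \<not> nsat (N, V) w \<phi>"
| "nsat (N, V) w (Disj \<phi> \<psi>) \<longleftrightarrow> nsat (N, V) w \<phi> \<or> nsat (N, V) w \<psi>"
| "nsat (N, V) w (Dia n \<phi>) \<longleftrightarrow> {v \<in> nworlds N. nsat (N, V) v \<phi>} \<in> nbhds N n w"

definition Pow_ge :: "nat \<Rightarrow> 'w set \<Rightarrow> 'w set set" where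
  "Pow_ge n X = {X'. X' \<subseteq> X \<and> card_ge X' n}"

definition upclosure :: "'w set \<Rightarrow> 'w set set \<Rightarrow> 'w set set" where
  "upclosure W \<Gamma> = {Y \<in> Pow W. \<exists>X \<in> \<Gamma>. X \<subseteq> Y}"

definition graded_nframe :: "'w kframe \<Rightarrow> 'w nframe" where
  "graded_nframe F =
     \<lparr> nworlds = kworlds F,
       nbhds = (\<lambda>n w. upclosure (kworlds F) (Pow_ge n (succs F w))) \<rparr>"

lemma nbhd_frame_graded_nframe: "nbhd_frame (graded_nframe F)"
  by (auto simp: nbhd_frame_def graded_nframe_def upclosure_def)

end

theory Submission
  imports Defs
begin

text \<open>By induction on the formula, only \<open>Dia\<close> matters. A truth set
  \<open>Y\<close> lies in the up-closure of the subsets of \<open>S\<close> of size at least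
  \<open>n\<close> iff \<open>S \<inter> Y\<close> has size at least \<open>n\<close>
  (\<open>mem_upclosure_Pow_ge\<close>), which is the Kripke clause.\<close>

lemma card_ge_mono: "card_ge X n \<Longrightarrow> X \<subseteq> Y \<Longrightarrow> card_ge Y n"
  unfolding card_ge_def by (rule lepoll_trans[OF _ subset_imp_lepoll])

text \<open>Every witness \<open>X\<close> lies inside \<open>S \<inter> Y\<close>, so by
  monotonicity \<open>S \<inter> Y\<close>, the largest candidate, is itself a witness.\<close>

lemma mem_upclosure_Pow_ge:
  assumes "Y \<subseteq> W"
  shows "Y \<in> upclosure W (Pow_ge n S) \<longleftrightarrow> card_ge (S \<inter> Y) n"
proof
  assume "Y \<in> upclosure W (Pow_ge n S)"
  then obtain X where "X \<subseteq> S \<inter> Y" "card_ge X n"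
    by (auto simp: upclosure_def Pow_ge_def)
  then show "card_ge (S \<inter> Y) n"
    by (blast intro: card_ge_mono)
next
  assume "card_ge (S \<inter> Y) n"
  then have "S \<inter> Y \<in> Pow_ge n S"
    by (simp add: Pow_ge_def)
  with assms show "Y \<in> upclosure W (Pow_ge n S)"
    unfolding upclosure_def by blast
qed

lemma nsat_graded_nframe_iff: "nsat (graded_nframe F, V) w \<phi> \<longleftrightarrow> ksat (F, V) w \<phi>"
\<comment> \<open>\<open>w\<close> is generalised because the \<open>Dia\<close> case compares truth
  sets, hence needs the hypothesis at every world.\<close>
proof (induction \<phi> arbitrary: w)
  case (Dia n \<phi>)
  then show ?case
    by (simp add: graded_nframe_def mem_upclosure_Pow_ge)
qed simp_all

theorem proposition4p3:
  fixes F :: "'w kframe" and V :: "'p \<Rightarrow> 'w set"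
  assumes "kripke_frame F" and "valuation (kworlds F) V"
  shows "\<forall>w \<in> kworlds F. \<forall>\<phi> :: 'p fm. ksat (F, V) w \<phi> \<longleftrightarrow> nsat (graded_nframe F, V) w \<phi>"
  by (simp add: nsat_graded_nframe_iff)

end
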